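(* Let $T>0$ and let $u\in L^1(0,T;\mathrm{Lip}(\mathbb{R}^2))$, with vorticity $\omega$, be a solution of the two-dimensional Euler equations $$\omega_t+u\cdot\nabla\omega=0,\qquad \nabla\cdot u=0,\quad \partial_1u_2-\partial_2u_1=\omega,\qquad \omega(x,0)=\omega_0(x).$$ Suppose $\omega_0\in C^{(\log\frac1s)^{-\gamma}}(x_0)$ for some $\gamma\in(0,\infty)$ and $x_0\in\mathbb{R}^2$. Then $$[\omega(\cdot,t)]_{(\log\frac1s)^{-\gamma};\,\varphi(x_0,t)}=[\omega_0]_{(\log\frac1s)^{-\gamma};\,x_0}\qquad\text{for all }t\in[0,T),$$ where $\varphi(x_0,t)$ denotes the particle trajectory generated by $u$ starting at $x_0$.
   Context: For a modulus of continuity $\delta=\delta(s)$ (a positive function of small $s>0$), a function $f$ on $\mathbb{R}^2$ and a point $x_0\in\mathbb{R}^2$, define $$[f]_{\delta(s);x_0}:=\lim_{r\to0}\ \sup_{x\in B_r(x_0),\,x\ne x_0}\frac{|f(x)-f(x_0)|}{\delta(|x-x_0|)}\in[0,+\infty],$$ where $B_r(x_0)$ is the ball of radius $r$ centred at $x_0$, and $$C^{\delta(s)}(x_0)=\{f\in L^\infty(\mathbb{R}^2)\,:\,[f]_{\delta(s);x_0}<+\infty\}.$$ The notation $(\log\frac1s)^{-\gamma}$ refers to the modulus $\delta(s)=(\log\frac1s)^{-\gamma}$, $0<s<1$. $\mathrm{Lip}(\mathbb{R}^2)$ is the space of Lipschitz continuous vector fields on $\mathbb{R}^2$; $u\in L^1(0,T;\mathrm{Lip}(\mathbb{R}^2))$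 means that $u$ is measurable in time, Lipschitz in space, and that $|u(0,t)|$ plus the Lipschitz constant of $u(\cdot,t)$ is integrable over $(0,T)$. The particle trajectory mapping $x_0\mapsto\varphi(x_0,t)$ from $\mathbb{R}^2$ to $\mathbb{R}^2$ generated by $u$ is the solution of $$\frac{\partial\varphi(x_0,t)}{\partial t}=u(\varphi(x_0,t),t)\ \text{ on }(0,T),\qquad \varphi(x_0,0)=x_0,$$ i.e. $\varphi(x_0,t)=x_0+\int_0^t u(\varphi(x_0,s),s)\,ds$. The transport equation for $\omega$ is understood in the sense that $\omega$ is the pointwise defined function transported by the flow, i.e. $\omega(\varphi(x,t),t)=\omega_0(x)$ for all $x\in\mathbb{R}^2$, $t\in[0,T)$. *)

theory Defs
  imports "HOL-Analysis.Analysis"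
begin

text \<open>The modulus \<open>\<delta>\<close> only matters near \<open>0\<close>, so its values at arguments where it fails to be
  positive are harmless. The limit exists in \<open>[0, \<infinity>]\<close>, as the supremum is monotone in \<open>r\<close>.\<close>

definition modulus_seminorm ::
    "(real \<Rightarrow> real) \<Rightarrow> ('a::metric_space \<Rightarrow> real) \<Rightarrow> 'a \<Rightarrow> ennreal" where
  "modulus_seminorm \<delta> f x0 =
     Lim (at_right 0) (\<lambda>r::real. SUP x\<in>ball x0 r - {x0}. ennreal (\<bar>f x - f x0\<bar> / \<delta> (dist x x0)))"

text \<open>Elements of \<open>L\<^sup>\<infinity>\<close> are taken as pointwise defined functions, not modulo null sets: the
  seminorm above depends on the values of the function.\<close>

definition L_infinity :: "('a::euclidean_space \<Rightarrow> real) set" where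
  "L_infinity = {f. f \<in> borel_measurable lebesgue \<and> (\<exists>M. AE x in lebesgue. \<bar>f x\<bar> \<le> M)}"

definition C_modulus ::
    "(real \<Rightarrow> real) \<Rightarrow> 'a::euclidean_space \<Rightarrow> ('a \<Rightarrow> real) set" where
  "C_modulus \<delta> x0 = {f \<in> L_infinity. modulus_seminorm \<delta> f x0 < \<infinity>}"

definition log_modulus :: "real \<Rightarrow> real \<Rightarrow> real" where
  "log_modulus \<gamma> s = ln (1 / s) powr (- \<gamma>)"

definition lipschitz_const :: "('a::metric_space \<Rightarrow> 'b::metric_space) \<Rightarrow> real" where
  "lipschitz_const f = Inf {L. L-lipschitz_on UNIV f}"

text \<open>Time-dependent fields take the space variable first and the time second;
  only times in \<open>(0, T)\<close> are relevant for the velocity.\<close>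

definition L1_Lip :: "real \<Rightarrow> (real^2 \<Rightarrow> real \<Rightarrow> real^2) set" where
  "L1_Lip T = {u.
     (\<forall>x. (\<lambda>t. u x t) \<in> borel_measurable (lebesgue_on {0<..<T})) \<and>
     (AE t in lebesgue_on {0<..<T}. \<exists>L. L-lipschitz_on UNIV (\<lambda>x. u x t)) \<and>
     (\<lambda>t. norm (u 0 t) + lipschitz_const (\<lambda>x. u x t)) absolutely_integrable_on {0<..<T}}"

definition particle_trajectory_map ::
    "real \<Rightarrow> (real^2 \<Rightarrow> real \<Rightarrow> real^2) \<Rightarrow> (real^2 \<Rightarrow> real \<Rightarrow> real^2) \<Rightarrow> bool" where
  "particle_trajectory_map T u \<phi> \<longleftrightarrow>
     (\<forall>x. \<forall>t\<in>{0..<T}.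
        (\<lambda>s. u (\<phi> x s) s) absolutely_integrable_on {0<..<t} \<and>
        \<phi> x t = x + integral {0<..<t} (\<lambda>s. u (\<phi> x s) s))"

definition partial_deriv :: "2 \<Rightarrow> (real^2 \<Rightarrow> real) \<Rightarrow> real^2 \<Rightarrow> real" where
  "partial_deriv i f x = deriv (\<lambda>h. f (x + h *\<^sub>R axis i 1)) 0"

definition divergence :: "(real^2 \<Rightarrow> real^2) \<Rightarrow> real^2 \<Rightarrow> real" where
  "divergence v x = partial_deriv 1 (\<lambda>y. v y $ 1) x + partial_deriv 2 (\<lambda>y. v y $ 2) x"

definition curl :: "(real^2 \<Rightarrow> real^2) \<Rightarrow> real^2 \<Rightarrow> real" where
  "curl v x = partial_deriv 1 (\<lambda>y. v y $ 2) x - partial_deriv 2 (\<lambda>y. v y $ 1) x"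

text \<open>A Lipschitz field is differentiable almost everywhere (Rademacher), so the divergence and
  curl equations are imposed almost everywhere. The transport equation
  \<open>\<omega>\<^sub>t + u \<cdot> \<nabla>\<omega> = 0\<close> means that the pointwise defined \<open>\<omega>\<close> is carried by the flow \<open>\<phi>\<close> of \<open>u\<close>.\<close>

definition euler_solution ::
    "real \<Rightarrow> (real^2 \<Rightarrow> real \<Rightarrow> real^2) \<Rightarrow> (real^2 \<Rightarrow> real \<Rightarrow> real^2) \<Rightarrow>
     (real^2 \<Rightarrow> real \<Rightarrow> real) \<Rightarrow> (real^2 \<Rightarrow> real) \<Rightarrow> bool" where
  "euler_solution T u \<phi> \<omega> \<omega>0 \<longleftrightarrow>
     (\<forall>x. \<forall>t\<in>{0..<T}. \<omega> (\<phi> x t) t = \<omega>0 x) \<and>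
     (AE t in lebesgue_on {0<..<T}. AE x in lebesgue. divergence (\<lambda>y. u y t) x = 0) \<and>
     (AE t in lebesgue_on {0<..<T}. AE x in lebesgue. curl (\<lambda>y. u y t) x = \<omega> x t) \<and>
     (\<forall>x. \<omega> x 0 = \<omega>0 x)"

end

theory Submission
  imports Defs "HOL-Homology.Invariance_of_Domain" "HOL-Real_Asymp.Real_Asymp"
begin

text \<open>The vorticity is carried by the flow, so for \<open>\<psi> = \<phi>(\<cdot>, t)\<close> the difference quotient of
  \<open>\<omega>(\<cdot>, t)\<close> at \<open>\<psi> x\<close>, based at \<open>\<psi> x0\<close>, has the same numerator as that of \<open>\<omega>0\<close> at \<open>x\<close>, based at
  \<open>x0\<close>; only the distance inside the modulus changes. Three facts make this change invisible in
  the limit.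

  First, \<open>\<psi>\<close> is bi-Lipschitz (\<open>flow_bilipschitz\<close>). The distance \<open>w\<close> of two trajectories satisfies
  \<open>\<bar>w s - w r\<bar> \<le> \<integral>\<^sub>r\<^sup>s \<Lambda> w\<close> with \<open>\<Lambda>\<close> integrable in time, and a Gronwall argument applied forwards and
  backwards in time bounds each of \<open>w 0\<close>, \<open>w t\<close> by a multiple of the other
  (\<open>integral_growth_two_sided\<close>).

  Secondly, \<open>\<psi>\<close> maps punctured neighbourhoods of \<open>x0\<close> onto punctured neighbourhoods of \<open>\<psi> x0\<close>
  (\<open>filtermap_at_of_inj_continuous\<close>). That every point near \<open>\<psi> x0\<close> is reached by some trajectory
  follows from invariance of domain, which takes the place of solving the equation backwards.

  Thirdly, the logarithmic modulus is slowly varying at \<open>0\<close>: a change of \<open>s\<close> by a bounded factor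
  shifts \<open>ln (1 / s)\<close> by a bounded amount, which changes \<open>\<delta> s\<close> by a factor tending to \<open>1\<close>
  (\<open>log_modulus_slowly_varying\<close>). Hence both upper limits agree, as equality and not merely up to
  a constant (\<open>modulus_seminorm_transport\<close>).\<close>

section \<open>The seminorm as an upper limit\<close>

text \<open>The supremum over the punctured ball is monotone in the radius, so its limit is the infimum
  over all radii. As an upper limit along the filter \<open>at x0\<close>, the seminorm can be
  pushed forward along maps and compared by inequalities that hold eventually.\<close>

lemma modulus_seminorm_eq_Limsup:
  "modulus_seminorm \<delta> f x0 = Limsup (at x0) (\<lambda>x. ennreal (\<bar>f x - f x0\<bar> / \<delta> (dist x x0)))"
    (is "_ = Limsup _ ?q")
proof -
  let ?S = "\<lambda>r::real. SUP x\<in>ball x0 r - {x0}. ?q x"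
  have "filterlim ?S (nhds (INF r\<in>{0<..}. ?S r)) (at_right 0)"
  proof (rule decreasing_tendsto)
    show "\<forall>\<^sub>F r in at_right 0. (INF r\<in>{0<..}. ?S r) \<le> ?S r"
      by (auto simp: eventually_at_right_less intro!: INF_lower eventually_mono[OF eventually_at_right_less])
  next
    fix y assume "(INF r\<in>{0<..}. ?S r) < y"
    then obtain r where r: "r > 0" "?S r < y"
      by (auto simp: INF_less_iff)
    have "\<forall>\<^sub>F r' in at_right 0. r' < r"
      using r(1) by (rule eventually_at_right_real[THEN eventually_mono]) auto
    then show "\<forall>\<^sub>F r' in at_right 0. ?S r' < y"
    proof eventually_elim
      case (elim r')
      have "?S r' \<le> ?S r"
        using elim by (intro SUP_subset_mono) auto
      with r(2) show ?case by simp
    qed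
  qed
  then show ?thesis
    unfolding modulus_seminorm_def Limsup_at by (intro tendsto_Lim) simp_all
qed

text \<open>This is how a factor tending to \<open>1\<close> disappears from an upper limit.\<close>

lemma Limsup_le_if_eventually_le_mult:
  fixes f g :: "'a \<Rightarrow> ennreal"
  assumes "\<And>c::real. c > 1 \<Longrightarrow> \<forall>\<^sub>F x in F. f x \<le> ennreal c * g x"
  shows "Limsup F f \<le> Limsup F g"
proof (rule dense_ge)
  fix z assume z: "Limsup F g < z"
  show "Limsup F f \<le> z"
  proof (rule ennreal_le_epsilon)
    fix e :: real assume e: "e > 0" and "z < top_class.top"
    then obtain r where r: "r \<ge> 0" "z = ennreal r"
      by (cases z) auto
    \<comment> \<open>Close enough to \<open>1\<close> that the factor costs at most \<open>e\<close>; the denominator \<open>r + 1\<close> also covers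
      \<open>r = 0\<close>.\<close>
    define c where "c = 1 + e / (r + 1)"
    have "c > 1" using e r by (simp add: c_def)
    have "c * r \<le> r + e"
      using e r by (simp add: c_def field_simps)
    have "\<forall>\<^sub>F x in F. f x \<le> ennreal (c * r)"
      using Limsup_lessD[OF z] assms[OF \<open>c > 1\<close>]
    proof eventually_elim
      case (elim x)
      have "f x \<le> ennreal c * g x" by fact
      also have "\<dots> \<le> ennreal c * ennreal r"
        using elim(1) r by (intro mult_left_mono) auto
      finally show ?case
        using \<open>c > 1\<close> r by (simp add: ennreal_mult)
    qed
    then have "Limsup F f \<le> ennreal (c * r)"
      by (rule Limsup_bounded)
    also have "\<dots> \<le> z + ennreal e"
      using \<open>c * r \<le> r + e\<close> r e by (simp add: ennreal_leI flip: ennreal_plus)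
    finally show "Limsup F f \<le> z + ennreal e" .
  qed
qed

section \<open>Invariance under bi-Lipschitz changes of variable\<close>

text \<open>The quotient \<open>ln (K / s) / ln (1 / s)\<close> tends to \<open>1\<close> as \<open>s\<close> tends to \<open>0\<close>, and so does its power
  with exponent \<open>\<gamma>\<close>. The bound is uniform in \<open>s'\<close> because the logarithm is monotone: \<open>s' = s / K\<close>
  is the worst case. A single one-sided estimate suffices for a bi-Lipschitz map, as the roles of
  \<open>s\<close> and \<open>s'\<close> may be exchanged.\<close>

lemma log_modulus_slowly_varying:
  assumes "\<gamma> \<ge> 0" "K > 0" "c > (1::real)"
  shows "\<forall>\<^sub>F s in at_right 0. \<forall>s'. s \<le> K * s' \<longrightarrow> s' < 1 \<longrightarrow>
           1 / log_modulus \<gamma> s' \<le> c / log_modulus \<gamma> s"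
proof -
  have "filterlim (\<lambda>s. (ln (K / s) / ln (1 / s)) powr \<gamma>) (nhds (1 powr \<gamma>)) (at_right 0)"
  proof (rule tendsto_powr)
    show "filterlim (\<lambda>s. ln (K / s) / ln (1 / s)) (nhds 1) (at_right 0)"
      using assms(2) by real_asymp
  qed auto
  then have "\<forall>\<^sub>F s in at_right 0. (ln (K / s) / ln (1 / s)) powr \<gamma> < c"
    using assms(3) by (auto dest!: order_tendstoD(2)[where a = c])
  moreover have "\<forall>\<^sub>F s::real in at_right 0. s \<in> {0<..<min 1 K}"
    using assms(2) by (intro eventually_at_right_real) auto
  ultimately show ?thesis
  proof (eventually_elim, intro allI impI)
    fix s s' :: real
    assume ratio: "(ln (K / s) / ln (1 / s)) powr \<gamma> < c" and "s \<in> {0<..<min 1 K}"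
      and le: "s \<le> K * s'" and "s' < 1"
    then have s: "0 < s" "s < 1" "s < K" by auto
    have "0 < K * s'" using s le by linarith
    then have "s' > 0" using assms(2) by (simp add: zero_less_mult_iff)
    have "1 / s' \<le> K / s"
      using s le \<open>s' > 0\<close> by (simp add: field_simps)
    then have "ln (1 / s') \<le> ln (K / s)"
      using \<open>s' > 0\<close> s by (subst ln_le_cancel_iff) auto
    have pos: "ln (1 / s) > 0" "ln (1 / s') > 0" "ln (K / s) > 0"
      using s \<open>s' > 0\<close> \<open>s' < 1\<close> by (auto intro!: ln_gt_zero)
    have "ln (1 / s') powr \<gamma> \<le> ln (K / s) powr \<gamma>"
      using \<open>ln (1 / s') \<le> ln (K / s)\<close> pos assms(1) by (intro powr_mono2) auto
    also have "\<dots> = (ln (K / s) / ln (1 / s)) powr \<gamma> * ln (1 / s) powr \<gamma>"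
      using pos by (simp add: powr_divide)
    also have "\<dots> \<le> c * ln (1 / s) powr \<gamma>"
      using ratio by (intro mult_right_mono) auto
    finally show "1 / log_modulus \<gamma> s' \<le> c / log_modulus \<gamma> s"
      by (simp add: log_modulus_def powr_minus divide_inverse)
  qed
qed

text \<open>Continuity and injectivity give one inequality between the filters. The other one says that
  images of neighbourhoods are neighbourhoods, which is invariance of domain.\<close>

lemma filtermap_at_of_inj_continuous:
  fixes f :: "'a::euclidean_space \<Rightarrow> 'a"
  assumes "continuous_on UNIV f" "inj f"
  shows "filtermap f (at x) = at (f x)"
proof (rule antisym)
  have "filterlim f (at (f x)) (at x)"
    using assms by (auto simp: filterlim_at inj_eq eventually_at_filter
        continuous_on_eq_continuous_at continuous_at)
  then show "filtermap f (at x) \<le> at (f x)"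
    by (simp add: filterlim_def)
next
  show "at (f x) \<le> filtermap f (at x)"
  proof (rule filter_leI)
    fix P assume "eventually P (filtermap f (at x))"
    then obtain S where S: "open S" "x \<in> S" "\<And>y. y \<in> S \<Longrightarrow> y \<noteq> x \<Longrightarrow> P (f y)"
      by (auto simp: eventually_filtermap eventually_at_topological)
    have "open (f ` S)"
      using assms S(1) by (intro invariance_of_domain) (auto intro: continuous_on_subset inj_on_subset)
    then show "eventually P (at (f x))"
      unfolding eventually_at_topological using S by blast
  qed
qed

text \<open>Pulled back to \<open>x0\<close> along \<open>\<psi>\<close>, the difference quotients of \<open>g\<close> differ from those of \<open>f\<close> only in
  the argument of \<open>\<delta>\<close>. The two arguments are comparable and tend to \<open>0\<close>, so slow variation bounds
  each quotient by any given \<open>c > 1\<close> times the other.\<close>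

lemma modulus_seminorm_transport:
  fixes f :: "'a::metric_space \<Rightarrow> real" and g :: "'b::metric_space \<Rightarrow> real"
  assumes flt: "filtermap \<psi> (at x0) = at (\<psi> x0)"
    and inj: "inj \<psi>"
  assumes fg: "\<And>x. f x = g (\<psi> x)"
  assumes lip: "\<And>x. dist x x0 \<le> K * dist (\<psi> x) (\<psi> x0)" "\<And>x. dist (\<psi> x) (\<psi> x0) \<le> K * dist x x0"
  assumes slow: "\<And>c. c > 1 \<Longrightarrow> \<forall>\<^sub>F s in at_right 0. \<forall>s'. s \<le> K * s' \<longrightarrow> s' < 1 \<longrightarrow>
                    1 / \<delta> s' \<le> c / \<delta> s"
  shows "modulus_seminorm \<delta> g (\<psi> x0) = modulus_seminorm \<delta> f x0"
proof -
  let ?d = "\<lambda>x. dist x x0" and ?d' = "\<lambda>x. dist (\<psi> x) (\<psi> x0)"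
  define q where "q s x = ennreal (\<bar>f x - f x0\<bar> / \<delta> s)" for s x
  have \<psi>: "filterlim \<psi> (at (\<psi> x0)) (at x0)"
    by (simp add: filterlim_def flt)
  have d: "filterlim ?d (at_right 0) (at x0)"
    by (auto simp: filterlim_at eventually_at_filter intro!: tendsto_eq_intros)
  have d': "filterlim ?d' (at_right 0) (at x0)"
  proof -
    have "filterlim (\<lambda>y. dist y (\<psi> x0)) (at_right 0) (at (\<psi> x0))"
      by (auto simp: filterlim_at eventually_at_filter intro!: tendsto_eq_intros)
    then show ?thesis
      using \<psi> by (rule filterlim_compose)
  qed
  have small: "\<forall>\<^sub>F x in at x0. h x < 1" if "filterlim h (at_right 0) (at x0)" for h :: "'a \<Rightarrow> real"
    using that by (auto simp: filterlim_at dest: order_tendstoD(2)[where a = 1])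
  \<comment> \<open>Slow variation speaks of reciprocals of \<open>\<delta>\<close>; this passes from them to difference quotients.\<close>
  have mult: "q s' x \<le> ennreal c * q s x" if "1 / \<delta> s' \<le> c / \<delta> s" "c > 1" for s s' c x
  proof -
    have "\<bar>f x - f x0\<bar> * (1 / \<delta> s') \<le> \<bar>f x - f x0\<bar> * (c / \<delta> s)"
      using that by (intro mult_left_mono) auto
    then have "q s' x \<le> ennreal (c * (\<bar>f x - f x0\<bar> / \<delta> s))"
      unfolding q_def by (intro ennreal_leI) (simp add: mult_ac)
    then show ?thesis
      using that(2) by (simp add: q_def ennreal_mult' del: times_divide_eq_right)
  qed
  have "modulus_seminorm \<delta> g (\<psi> x0) = Limsup (at x0) (\<lambda>x. q (?d' x) x)"
    by (simp add: modulus_seminorm_eq_Limsup Limsup_filtermap_eq[OF inj] q_def fg flip: flt)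
  also have "\<dots> = Limsup (at x0) (\<lambda>x. q (?d x) x)"
  proof (intro antisym Limsup_le_if_eventually_le_mult)
    fix c :: real assume "c > 1"
    note slow = slow[OF this]
    show "\<forall>\<^sub>F x in at x0. q (?d' x) x \<le> ennreal c * q (?d x) x"
      using eventually_compose_filterlim[OF slow d] small[OF d']
      by eventually_elim (use lip \<open>c > 1\<close> in \<open>auto intro!: mult\<close>)
    show "\<forall>\<^sub>F x in at x0. q (?d x) x \<le> ennreal c * q (?d' x) x"
      using eventually_compose_filterlim[OF slow d'] small[OF d]
      by eventually_elim (use lip \<open>c > 1\<close> in \<open>auto intro!: mult\<close>)
  qed
  also have "\<dots> = modulus_seminorm \<delta> f x0"
    by (simp add: modulus_seminorm_eq_Limsup q_def)
  finally show ?thesis .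
qed

section \<open>The flow is bi-Lipschitz\<close>

lemma lipschitz_const_lipschitz:
  assumes "L-lipschitz_on UNIV f"
  shows "(lipschitz_const f)-lipschitz_on UNIV f"
proof (rule lipschitz_onI)
  let ?A = "{L. L-lipschitz_on UNIV f}"
  have ne: "?A \<noteq> {}" using assms by auto
  show "0 \<le> lipschitz_const f"
    unfolding lipschitz_const_def using ne by (intro cInf_greatest) (auto dest: lipschitz_on_nonneg)
  fix x y
  show "dist (f x) (f y) \<le> lipschitz_const f * dist x y"
  proof (cases "x = y")
    case False
    have "dist (f x) (f y) / dist x y \<le> lipschitz_const f"
      unfolding lipschitz_const_def using ne False
      by (intro cInf_greatest) (auto simp: divide_le_eq dest: lipschitz_onD)
    then show ?thesis using False by (simp add: divide_le_eq)
  qed simp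
qed

text \<open>A Gronwall inequality for a merely integrable coefficient, in both time directions at once.
  On an interval over which \<open>\<Lambda>\<close> integrates to at most \<open>1 / 2\<close>, let \<open>M\<close> be the maximum of
  \<open>norm D\<close>. Its distance to any other value of \<open>norm D\<close> there is at most \<open>M / 2\<close>, so any two values
  differ at most by a factor \<open>2\<close>. The indefinite integral of \<open>\<Lambda>\<close> is uniformly continuous, so
  finitely many such intervals, say \<open>n\<close>, cover \<open>[0, t]\<close>. This yields the constant \<open>2 ^ n\<close>, which
  depends on \<open>\<Lambda>\<close> and \<open>t\<close> only and thus serves all \<open>D\<close> simultaneously.\<close>

lemma integral_growth_two_sided:
  assumes \<Lambda>: "\<Lambda> integrable_on {0..t}" and "t \<ge> 0"
  obtains K where "K \<ge> 1" and
    "\<And>D :: real \<Rightarrow> 'a::real_normed_vector.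
       continuous_on {0..t} D \<Longrightarrow>
       (\<And>r s M. 0 \<le> r \<Longrightarrow> r \<le> s \<Longrightarrow> s \<le> t \<Longrightarrow> (\<And>\<tau>. \<tau> \<in> {r..s} \<Longrightarrow> norm (D \<tau>) \<le> M) \<Longrightarrow>
          norm (D s - D r) \<le> M * integral {r..s} \<Lambda>) \<Longrightarrow>
       norm (D t) \<le> K * norm (D 0) \<and> norm (D 0) \<le> K * norm (D t)"
proof -
  let ?F = "\<lambda>s. integral {0..s} \<Lambda>"
  have "uniformly_continuous_on {0..t} ?F"
    using \<Lambda> by (intro compact_uniformly_continuous indefinite_integral_continuous_1) auto
  then obtain \<eta> where "\<eta> > 0" and \<eta>:
    "\<And>r s. r \<in> {0..t} \<Longrightarrow> s \<in> {0..t} \<Longrightarrow> dist s r < \<eta> \<Longrightarrow> dist (?F s) (?F r) < 1/2"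
    by (force simp: uniformly_continuous_on_def dest: spec[of _ "1/2"])
  obtain n :: nat where n: "t / \<eta> < real n"
    using reals_Archimedean2 by blast
  with \<open>t \<ge> 0\<close> \<open>\<eta> > 0\<close> have "n > 0"
    by (metis divide_nonneg_pos gr0I not_less of_nat_0)
  define p where "p i = t * real i / real n" for i
  have p_mono: "p i \<le> p j" if "i \<le> j" for i j
    using that \<open>t \<ge> 0\<close> by (simp add: p_def divide_right_mono mult_left_mono)
  have p_ends: "p 0 = 0" "p n = t" using \<open>n > 0\<close> by (auto simp: p_def)
  have p_step: "p (Suc i) - p i < \<eta>" for i
    using n \<open>n > 0\<close> \<open>\<eta> > 0\<close> by (simp add: p_def field_simps)
  show thesis
  proof (rule that[of "2 ^ n"])
    show "(1::real) \<le> 2 ^ n" by simp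
  next
    fix D :: "real \<Rightarrow> 'a"
    assume D: "continuous_on {0..t} D"
      and incr: "\<And>r s M. 0 \<le> r \<Longrightarrow> r \<le> s \<Longrightarrow> s \<le> t \<Longrightarrow>
        (\<And>\<tau>. \<tau> \<in> {r..s} \<Longrightarrow> norm (D \<tau>) \<le> M) \<Longrightarrow> norm (D s - D r) \<le> M * integral {r..s} \<Lambda>"
    have short: "norm (D x) \<le> 2 * norm (D y)"
      if ab: "0 \<le> a" "a \<le> b" "b \<le> t" "b - a < \<eta>" and xy: "x \<in> {a..b}" "y \<in> {a..b}" for a b x y
    proof -
      have "\<exists>m\<in>{a..b}. \<forall>\<tau>\<in>{a..b}. norm (D \<tau>) \<le> norm (D m)"
        using ab by (intro continuous_attains_sup continuous_on_norm continuous_on_subset[OF D]) auto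
      then obtain m where m: "m \<in> {a..b}" "\<And>\<tau>. \<tau> \<in> {a..b} \<Longrightarrow> norm (D \<tau>) \<le> norm (D m)" by blast
      have half: "norm (D s - D r) \<le> norm (D m) * (1/2)" if "r \<in> {a..b}" "s \<in> {a..b}" "r \<le> s" for r s
      proof -
        have "?F r + integral {r..s} \<Lambda> = ?F s"
          using that ab by (intro Henstock_Kurzweil_Integration.integral_combine
            integrable_on_subinterval[OF \<Lambda>]) auto
        moreover have "dist (?F s) (?F r) < 1/2"
          using that ab by (intro \<eta>) (auto simp: dist_real_def)
        ultimately have "integral {r..s} \<Lambda> \<le> 1/2"
          unfolding dist_real_def by linarith
        moreover have "norm (D s - D r) \<le> norm (D m) * integral {r..s} \<Lambda>"
          using that ab m by (intro incr) auto
        ultimately show ?thesis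
          by (meson mult_left_mono norm_ge_zero order_trans)
      qed
      have "norm (D m - D y) \<le> norm (D m) * (1/2)"
        using half[of m y] half[of y m] m(1) xy(2) by (cases "m \<le> y") (auto simp: norm_minus_commute)
      then have "norm (D m) \<le> 2 * norm (D y)"
        using norm_triangle_ineq2[of "D m" "D y"] by simp
      then show ?thesis using m(2)[OF xy(1)] by simp
    qed
    have "norm (D (p i)) \<le> 2 ^ i * norm (D 0) \<and> norm (D 0) \<le> 2 ^ i * norm (D (p i))" if "i \<le> n" for i
      using that
    proof (induction i)
      case (Suc i)
      have *: "0 \<le> p i" "p i \<le> p (Suc i)" "p (Suc i) \<le> t"
        using p_mono[of 0 i] p_mono[of "Suc i" n] p_mono[of i "Suc i"] p_ends Suc.prems by auto
      have step: "norm (D (p (Suc i))) \<le> 2 * norm (D (p i))"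
          "norm (D (p i)) \<le> 2 * norm (D (p (Suc i)))"
        using * by (auto intro!: short[OF * p_step])
      have IH: "norm (D (p i)) \<le> 2 ^ i * norm (D 0)" "norm (D 0) \<le> 2 ^ i * norm (D (p i))"
        using Suc by auto
      have "norm (D (p (Suc i))) \<le> 2 ^ Suc i * norm (D 0)"
        using step(1) IH(1) by simp
      moreover have "norm (D 0) \<le> 2 ^ Suc i * norm (D (p (Suc i)))"
        using order_trans[OF IH(2) mult_left_mono[OF step(2)]] by (simp add: mult_ac)
      ultimately show ?case ..
    qed (simp add: p_ends)
    from this[of n] show "norm (D t) \<le> 2 ^ n * norm (D 0) \<and> norm (D 0) \<le> 2 ^ n * norm (D t)"
      by (simp add: p_ends)
  qed
qed

text \<open>The witness \<open>\<Lambda>\<close> is the whole integrand \<open>norm (u 0 t) + lipschitz_const (\<lambda>x. u x t)\<close>: it still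
  dominates the Lipschitz constant, and its integrability is immediate, whereas that of the second
  summand alone would require a measurability argument.\<close>

lemma L1_Lip_lipschitz_bound:
  assumes "u \<in> L1_Lip T"
  obtains \<Lambda> N where "negligible N" "\<Lambda> integrable_on {0..T}"
    "\<And>s. s \<in> {0..T} - N \<Longrightarrow> (\<Lambda> s)-lipschitz_on UNIV (\<lambda>x. u x s)"
proof -
  define \<Lambda> where "\<Lambda> t = norm (u 0 t) + lipschitz_const (\<lambda>x. u x t)" for t
  have "AE t in lebesgue_on {0<..<T}. \<exists>L. L-lipschitz_on UNIV (\<lambda>x. u x t)"
    using assms by (simp add: L1_Lip_def)
  then have "AE t in lebesgue. t \<in> {0<..<T} \<longrightarrow> (\<exists>L. L-lipschitz_on UNIV (\<lambda>x. u x t))"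
    by (subst (asm) AE_restrict_space_iff) auto
  then obtain N where N: "negligible N"
    "{t. \<not> (t \<in> {0<..<T} \<longrightarrow> (\<exists>L. L-lipschitz_on UNIV (\<lambda>x. u x t)))} \<subseteq> N"
    unfolding eventually_ae_filter_negligible by blast
  show thesis
  proof
    \<comment> \<open>The hypotheses on \<open>u\<close> concern the open interval, so its end points join the null set.\<close>
    show "negligible (N \<union> {0, T})"
      using N by (auto simp: negligible_Un_eq)
    have "\<Lambda> absolutely_integrable_on {0<..<T}"
      using assms by (simp add: L1_Lip_def \<Lambda>_def[abs_def])
    then show "\<Lambda> integrable_on {0..T}"
      by (simp add: integrable_on_Icc_iff_Ioo absolutely_integrable_on_def)
    fix s assume "s \<in> {0..T} - (N \<union> {0, T})"
    then have "s \<in> {0<..<T}" "s \<notin> N" by auto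
    then obtain L where "L-lipschitz_on UNIV (\<lambda>x. u x s)" using N(2) by blast
    then have "(lipschitz_const (\<lambda>x. u x s))-lipschitz_on UNIV (\<lambda>x. u x s)"
      by (rule lipschitz_const_lipschitz)
    then show "(\<Lambda> s)-lipschitz_on UNIV (\<lambda>x. u x s)"
      by (rule lipschitz_on_le) (simp add: \<Lambda>_def)
  qed
qed

text \<open>The difference of two trajectories grows at most at the rate \<open>\<Lambda>\<close> times its size, so the
  two-sided Gronwall inequality applies, with one constant for all pairs of trajectories.\<close>

lemma flow_bilipschitz:
  assumes u: "u \<in> L1_Lip T" and \<phi>: "particle_trajectory_map T u \<phi>" and t: "t \<in> {0..<T}"
  obtains K where "K \<ge> 1"
    "\<And>x y. dist (\<phi> x t) (\<phi> y t) \<le> K * dist x y"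
    "\<And>x y. dist x y \<le> K * dist (\<phi> x t) (\<phi> y t)"
proof -
  obtain \<Lambda> N where N: "negligible N" and \<Lambda>: "\<Lambda> integrable_on {0..T}"
    and lip: "\<And>s. s \<in> {0..T} - N \<Longrightarrow> (\<Lambda> s)-lipschitz_on UNIV (\<lambda>x. u x s)"
    by (rule L1_Lip_lipschitz_bound[OF u]) blast
  have \<Lambda>t: "\<Lambda> integrable_on {0..t}"
    using integrable_on_subinterval[OF \<Lambda>] t by auto
  obtain K where "K \<ge> 1" and K: "\<And>D :: real \<Rightarrow> real^2.
       continuous_on {0..t} D \<Longrightarrow>
       (\<And>r s M. 0 \<le> r \<Longrightarrow> r \<le> s \<Longrightarrow> s \<le> t \<Longrightarrow> (\<And>\<tau>. \<tau> \<in> {r..s} \<Longrightarrow> norm (D \<tau>) \<le> M) \<Longrightarrow>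
          norm (D s - D r) \<le> M * integral {r..s} \<Lambda>) \<Longrightarrow>
       norm (D t) \<le> K * norm (D 0) \<and> norm (D 0) \<le> K * norm (D t)"
  proof (rule integral_growth_two_sided[OF \<Lambda>t])
    show "0 \<le> t" using t by simp
  qed blast
  let ?v = "\<lambda>x s. u (\<phi> x s) s"
  have v: "?v x integrable_on {0..t}" for x
    using \<phi> t by (auto simp: particle_trajectory_map_def absolutely_integrable_on_def
        integrable_on_Icc_iff_Ioo)
  have \<phi>_eq: "\<phi> x s = x + integral {0..s} (?v x)" if "s \<in> {0..t}" for x s
    using \<phi> t that by (auto simp: particle_trajectory_map_def integral_open_interval_real)
  have "dist (\<phi> x t) (\<phi> y t) \<le> K * dist x y \<and> dist x y \<le> K * dist (\<phi> x t) (\<phi> y t)" for x y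
  proof -
    define D where "D s = \<phi> x s - \<phi> y s" for s
    have cont: "continuous_on {0..t} (\<lambda>s. \<phi> x s)" for x
    proof -
      have "continuous_on {0..t} (\<lambda>s. x + integral {0..s} (?v x))"
        by (intro continuous_intros indefinite_integral_continuous_1 v)
      then show ?thesis
        by (subst continuous_on_cong[OF refl \<phi>_eq]) auto
    qed
    have "norm (D t) \<le> K * norm (D 0) \<and> norm (D 0) \<le> K * norm (D t)"
    proof (rule K)
      show "continuous_on {0..t} D"
        unfolding D_def by (intro continuous_intros cont)
    next
      fix r s M
      assume rs: "0 \<le> r" "r \<le> s" "s \<le> t" and M: "\<And>\<tau>. \<tau> \<in> {r..s} \<Longrightarrow> norm (D \<tau>) \<le> M"
      have sub: "?v z integrable_on {r..s}" for z
        using integrable_on_subinterval[OF v] rs by auto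
      have \<phi>_diff: "\<phi> z s - \<phi> z r = integral {r..s} (?v z)" for z
      proof -
        have "integral {0..r} (?v z) + integral {r..s} (?v z) = integral {0..s} (?v z)"
          using rs integrable_on_subinterval[OF v]
          by (intro Henstock_Kurzweil_Integration.integral_combine) auto
        then show ?thesis using rs by (simp add: \<phi>_eq algebra_simps)
      qed
      \<comment> \<open>Setting both integrands to \<open>0\<close> on the null set of bad times makes the Lipschitz bound hold
        everywhere without changing the integrals.\<close>
      define g where "g \<tau> = (if \<tau> \<in> N then 0 else ?v x \<tau> - ?v y \<tau>)" for \<tau>
      define h where "h \<tau> = (if \<tau> \<in> N then 0 else M * \<Lambda> \<tau>)" for \<tau>
      have D_eq: "D s - D r = integral {r..s} (\<lambda>\<tau>. ?v x \<tau> - ?v y \<tau>)"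
        using \<phi>_diff[of x] \<phi>_diff[of y] sub
        by (simp add: D_def Henstock_Kurzweil_Integration.integral_diff algebra_simps)
      also have "\<dots> = integral {r..s} g"
        by (rule integral_spike[OF N]) (simp add: g_def)
      finally have "norm (D s - D r) = norm (integral {r..s} g)" by simp
      also have "\<dots> \<le> integral {r..s} h"
      proof (rule Henstock_Kurzweil_Integration.integral_norm_bound_integral)
        show "g integrable_on {r..s}"
          by (rule integrable_spike[OF integrable_diff[OF sub[of x] sub[of y]] N]) (simp add: g_def)
        have "(\<lambda>\<tau>. M * \<Lambda> \<tau>) integrable_on {r..s}"
          using integrable_on_subinterval[OF \<Lambda>t, of r s] rs by (intro integrable_on_mult_right) auto
        then show "h integrable_on {r..s}"
          by (rule integrable_spike[OF _ N]) (simp add: h_def)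
        fix \<tau> assume \<tau>: "\<tau> \<in> {r..s}"
        show "norm (g \<tau>) \<le> h \<tau>"
        proof (cases "\<tau> \<in> N")
          case False
          then have L: "(\<Lambda> \<tau>)-lipschitz_on UNIV (\<lambda>x. u x \<tau>)"
            using \<tau> rs t by (intro lip) auto
          then have "norm (?v x \<tau> - ?v y \<tau>) \<le> \<Lambda> \<tau> * norm (D \<tau>)"
            using lipschitz_onD[OF L, of "\<phi> x \<tau>" "\<phi> y \<tau>"] by (simp add: dist_norm D_def)
          also have "\<dots> \<le> \<Lambda> \<tau> * M"
            using M[OF \<tau>] lipschitz_on_nonneg[OF L] by (intro mult_left_mono)
          finally show ?thesis using False by (simp add: g_def h_def mult.commute)
        qed (simp add: g_def h_def)
      qed
      also have "\<dots> = integral {r..s} (\<lambda>\<tau>. M * \<Lambda> \<tau>)"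
        by (rule integral_spike[OF N]) (simp add: h_def)
      finally show "norm (D s - D r) \<le> M * integral {r..s} \<Lambda>" by simp
    qed
    moreover have "D 0 = x - y"
      using t by (simp add: D_def \<phi>_eq)
    ultimately show ?thesis
      by (simp add: D_def dist_norm)
  qed
  with that \<open>K \<ge> 1\<close> show thesis by blast
qed

section \<open>Transport of the logarithmic seminorm\<close>

theorem corollary1p1:
  fixes T \<gamma> :: real
    and u \<phi> :: "real^2 \<Rightarrow> real \<Rightarrow> real^2"
    and \<omega> :: "real^2 \<Rightarrow> real \<Rightarrow> real"
    and \<omega>0 :: "real^2 \<Rightarrow> real"
    and x0 :: "real^2"
  assumes "T > 0"
    and "u \<in> L1_Lip T"
    and "particle_trajectory_map T u \<phi>"
    and "euler_solution T u \<phi> \<omega> \<omega>0"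
    and "\<gamma> > 0"
    and "\<omega>0 \<in> C_modulus (log_modulus \<gamma>) x0"
  shows "\<forall>t\<in>{0..<T}.
    modulus_seminorm (log_modulus \<gamma>) (\<lambda>x. \<omega> x t) (\<phi> x0 t) =
    modulus_seminorm (log_modulus \<gamma>) \<omega>0 x0"
proof
  fix t assume t: "t \<in> {0..<T}"
  obtain K where K: "K \<ge> 1"
    "\<And>x y. dist (\<phi> x t) (\<phi> y t) \<le> K * dist x y"
    "\<And>x y. dist x y \<le> K * dist (\<phi> x t) (\<phi> y t)"
    by (rule flow_bilipschitz[OF assms(2,3) t]) blast
  have inj: "inj (\<lambda>x. \<phi> x t)"
  proof (rule injI)
    fix x y assume "\<phi> x t = \<phi> y t"
    then show "x = y" using K(3)[of x y] by simp
  qed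
  have "K-lipschitz_on UNIV (\<lambda>x. \<phi> x t)"
    using K by (intro lipschitz_onI) auto
  then have "filtermap (\<lambda>x. \<phi> x t) (at x0) = at (\<phi> x0 t)"
    using inj by (intro filtermap_at_of_inj_continuous lipschitz_on_continuous_on)
  then show "modulus_seminorm (log_modulus \<gamma>) (\<lambda>x. \<omega> x t) (\<phi> x0 t) =
    modulus_seminorm (log_modulus \<gamma>) \<omega>0 x0"
  proof (rule modulus_seminorm_transport[where K = K])
    show "\<omega>0 x = \<omega> (\<phi> x t) t" for x
      using assms(4) t by (simp add: euler_solution_def)
  qed (use K inj assms(5) in \<open>auto intro: log_modulus_slowly_varying\<close>)
qed

end
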